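(* Let $K$ be a field of characteristic $0$, let $n \ge 5$, and let $\alpha,\beta \in K$. If $\alpha \neq \beta$ and $\alpha \neq -\beta$, then $$\mathrm{Stab}\bigl(\det\nolimits^{(\alpha,\beta)}_n\bigr) = \mathrm{Stab}(\det\nolimits_n) \cap \mathrm{Stab}(\mathrm{perm}_n)$$ as subgroups of $GL(\mathrm{Mat}_n(K))$.
   Context: $S_n$ is the symmetric group, $A_n$ the alternating group, and $\bar{A}_n := S_n \setminus A_n$. For an $n\times n$ matrix $A=(a_{ij})$, the even determinant is $\det_{A_n}(A) := \sum_{\sigma \in A_n} \prod_{i=1}^n a_{i\sigma(i)}$ and the odd determinant is $\det_{\bar{A}_n}(A) := \sum_{\sigma \in \bar{A}_n} \prod_{i=1}^n a_{i\sigma(i)}$. For $\alpha,\beta\in K$ the generalized determinant is $\det^{(\alpha,\beta)}(A) := \alpha \det_{A_n}(A) + \beta \det_{\bar{A}_n}(A)$. Let $X=(x_{ij})_{1\le i,j\le n}$ be the generic matrix, where the $x_{ij}$ are the standard (coordinate) basis of the dual space $\mathrm{Mat}_n^*$ of $\mathrm{Mat}_n(K)$. Write $\det_n := \det(X)$, $\mathrm{perm}_n := \mathrm{perm}(X)$ (the permanent $\sum_{\sigma\in S_n}\prod_i x_{i\sigma(i)}$) and $\det^{(\alpha,\beta)}_n := \det^{(\alpha,\beta)}(X)$, regarded as elements of $\mathrm{Sym}^n(\mathrm{Mat}_n^* )$, i.e. homogeneous polynomials of degree $n$ on $\mathrm{Mat}_n(K)$. $GL(\mathrm{Mat}_n(K))$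 is the group of $K$-linear automorphisms of the $n^2$-dimensional space $\mathrm{Mat}_n(K)$, acting on polynomials $f$ by $(T\cdot f)(X) = f(T^{-1}(X))$. For $f \in \mathrm{Sym}^n(\mathrm{Mat}_n^* )$, $\mathrm{Stab}(f) := \{T \in GL(\mathrm{Mat}_n(K)) \mid T\cdot f = f\}$; equivalently, the set of $T$ with $f(T(X)) = f(X)$. *)

theory Defs
  imports "HOL-Analysis.Determinants" "HOL-Algebra.Group_Action"
begin

definition even_det :: "'a::comm_ring_1^'n^'n \<Rightarrow> 'a" where
  "even_det A = (\<Sum>p | p permutes (UNIV :: 'n set) \<and> evenperm p. \<Prod>i\<in>UNIV. A $ i $ p i)"

definition odd_det :: "'a::comm_ring_1^'n^'n \<Rightarrow> 'a" where
  "odd_det A = (\<Sum>p | p permutes (UNIV :: 'n set) \<and> \<not> evenperm p. \<Prod>i\<in>UNIV. A $ i $ p i)"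

definition gen_det :: "'a::comm_ring_1 \<Rightarrow> 'a \<Rightarrow> 'a^'n^'n \<Rightarrow> 'a" where
  "gen_det \<alpha> \<beta> A = \<alpha> * even_det A + \<beta> * odd_det A"

definition permanent :: "'a::comm_ring_1^'n^'n \<Rightarrow> 'a" where
  "permanent A = (\<Sum>p | p permutes (UNIV :: 'n set). \<Prod>i\<in>UNIV. A $ i $ p i)"

text \<open>The library scaling \<open>*s\<close> on \<open>'a^'n^'n\<close> expects scalars in \<open>'a^'n\<close>, so scaling
  by elements of the ground ring has to be introduced.\<close>

definition mat_scale :: "'a::comm_ring_1 \<Rightarrow> 'a^'n^'n \<Rightarrow> 'a^'n^'n" where
  "mat_scale c A = (\<chi> i j. c * A $ i $ j)"

definition GL_mat :: "('a::field^'n^'n \<Rightarrow> 'a^'n^'n) monoid" where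
  "GL_mat = \<lparr>carrier = {T. Vector_Spaces.linear mat_scale mat_scale T \<and> bij T},
             mult = (\<circ>), one = id\<rparr>"

text \<open>Polynomials on the matrix space are represented by the functions they induce; over an
  infinite field this loses nothing, since a polynomial is determined by its values.\<close>

definition GL_act :: "('a^'n^'n \<Rightarrow> 'a^'n^'n) \<Rightarrow> ('a^'n^'n \<Rightarrow> 'a) \<Rightarrow> ('a::field^'n^'n \<Rightarrow> 'a)" where
  "GL_act T f = (\<lambda>X. f ((inv\<^bsub>GL_mat\<^esub> T) X))"

abbreviation Stab :: "('a::field^'n^'n \<Rightarrow> 'a) \<Rightarrow> ('a^'n^'n \<Rightarrow> 'a^'n^'n) set" where
  "Stab f \<equiv> stabilizer GL_mat GL_act f"

lemma det_eq_gen_det: "det A = gen_det 1 (-1) A"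
proof -
  have "det A = (\<Sum>p | p permutes UNIV. (if evenperm p then \<Prod>i\<in>UNIV. A $ i $ p i else 0)
      - (if \<not> evenperm p then \<Prod>i\<in>UNIV. A $ i $ p i else 0))"
    unfolding det_def by (intro sum.cong refl) (simp add: sign_def)
  also have "\<dots> = even_det A - odd_det A"
    unfolding even_det_def odd_det_def sum_subtractf
    by (simp add: sum.inter_filter [symmetric])
  finally show ?thesis by (simp add: gen_det_def)
qed

lemma permanent_eq_gen_det: "permanent A = gen_det 1 1 A"
proof -
  have "permanent A = (\<Sum>p | p permutes UNIV. (if evenperm p then \<Prod>i\<in>UNIV. A $ i $ p i else 0)
      + (if \<not> evenperm p then \<Prod>i\<in>UNIV. A $ i $ p i else 0))"
    unfolding permanent_def by (intro sum.cong refl) simp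
  also have "\<dots> = even_det A + odd_det A"
    unfolding even_det_def odd_det_def sum.distrib
    by (simp add: sum.inter_filter [symmetric])
  finally show ?thesis by (simp add: gen_det_def)
qed

lemma vector_space_mat_scale: "vector_space (mat_scale :: 'a::field \<Rightarrow> 'a^'n^'n \<Rightarrow> _)"
  by unfold_locales (simp_all add: mat_scale_def vec_eq_iff algebra_simps)

lemma linear_mat_scale_iff:
  fixes T :: "'a::field^'n^'n \<Rightarrow> 'a^'n^'n"
  shows "Vector_Spaces.linear mat_scale mat_scale T \<longleftrightarrow>
    (\<forall>X Y. T (X + Y) = T X + T Y) \<and> (\<forall>c X. T (mat_scale c X) = mat_scale c (T X))"
  using vector_space_mat_scale
  by (auto simp: Vector_Spaces.linear_def module_hom_def module_hom_axioms_def
      module_iff_vector_space)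

lemma group_GL_mat: "group (GL_mat :: ('a::field^'n^'n \<Rightarrow> 'a^'n^'n) monoid)"
proof (rule groupI)
  fix S T :: "'a^'n^'n \<Rightarrow> 'a^'n^'n"
  assume "S \<in> carrier GL_mat" "T \<in> carrier GL_mat"
  then show "S \<otimes>\<^bsub>GL_mat\<^esub> T \<in> carrier GL_mat"
    by (simp add: GL_mat_def linear_mat_scale_iff bij_comp)
next
  fix T :: "'a^'n^'n \<Rightarrow> 'a^'n^'n"
  assume T: "T \<in> carrier GL_mat"
  then have b: "bij T" and l: "Vector_Spaces.linear mat_scale mat_scale T"
    by (simp_all add: GL_mat_def)
  have inv: "Hilbert_Choice.inv T Z = W" if "Z = T W" for Z W
    using b that by (simp add: bij_is_inj)
  have surj: "T (Hilbert_Choice.inv T X) = X" for X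
    using b by (simp add: bij_is_surj surj_f_inv_f)
  have "Hilbert_Choice.inv T (X + Y) = Hilbert_Choice.inv T X + Hilbert_Choice.inv T Y" for X Y
    by (rule inv) (use l in \<open>simp add: linear_mat_scale_iff surj\<close>)
  moreover have "Hilbert_Choice.inv T (mat_scale c X) = mat_scale c (Hilbert_Choice.inv T X)" for c X
    by (rule inv) (use l in \<open>simp add: linear_mat_scale_iff surj\<close>)
  ultimately have "Hilbert_Choice.inv T \<in> carrier GL_mat"
    using b by (simp add: GL_mat_def linear_mat_scale_iff bij_imp_bij_inv)
  moreover have "Hilbert_Choice.inv T \<circ> T = id"
    using b by (simp add: bij_is_inj)
  ultimately show "\<exists>S\<in>carrier GL_mat. S \<otimes>\<^bsub>GL_mat\<^esub> T = \<one>\<^bsub>GL_mat\<^esub>"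
    by (auto simp: GL_mat_def)
qed (auto simp: GL_mat_def linear_mat_scale_iff comp_assoc)

lemma GL_act_mult:
  assumes "S \<in> carrier GL_mat" "T \<in> carrier GL_mat"
  shows "GL_act (S \<otimes>\<^bsub>GL_mat\<^esub> T) f = GL_act S (GL_act T f)"
proof -
  have "inv\<^bsub>GL_mat\<^esub> (S \<otimes>\<^bsub>GL_mat\<^esub> T) = inv\<^bsub>GL_mat\<^esub> T \<circ> inv\<^bsub>GL_mat\<^esub> S"
    using group.inv_mult_group [OF group_GL_mat assms] by (simp add: GL_mat_def)
  then show ?thesis by (simp add: GL_act_def)
qed

lemma inv_GL_mat_cancel:
  assumes "T \<in> carrier GL_mat"
  shows "(inv\<^bsub>GL_mat\<^esub> T) (T X) = X" "T ((inv\<^bsub>GL_mat\<^esub> T) X) = X"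
  using group.l_inv [OF group_GL_mat assms] group.r_inv [OF group_GL_mat assms]
  by (auto simp: GL_mat_def fun_eq_iff)

lemma GL_act_one: "GL_act \<one>\<^bsub>GL_mat\<^esub> f = f"
  unfolding GL_act_def monoid.inv_one [OF group.is_monoid [OF group_GL_mat]]
  by (simp add: GL_mat_def)

lemma Stab_iff: "T \<in> Stab f \<longleftrightarrow> T \<in> carrier GL_mat \<and> (\<forall>X. f (T X) = f X)"
proof (cases "T \<in> carrier GL_mat")
  case True
  then show ?thesis
    unfolding stabilizer_def GL_act_def fun_eq_iff mem_Collect_eq
    by (metis inv_GL_mat_cancel)
qed (simp add: stabilizer_def)

lemma group_action_GL_act: "group_action GL_mat UNIV GL_act"
proof -
  have "bij (GL_act T)" if "T \<in> carrier GL_mat" for T :: "'a::field^'n^'n \<Rightarrow> 'a^'n^'n"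
  proof (rule o_bij)
    let ?S = "inv\<^bsub>GL_mat\<^esub> T"
    have S: "?S \<in> carrier GL_mat"
      by (rule group.inv_closed [OF group_GL_mat that])
    show "GL_act ?S \<circ> GL_act T = id"
      using GL_act_mult [OF S that] group.l_inv [OF group_GL_mat that]
      by (simp add: fun_eq_iff GL_act_one)
    show "GL_act T \<circ> GL_act ?S = id"
      using GL_act_mult [OF that S] group.r_inv [OF group_GL_mat that]
      by (simp add: fun_eq_iff GL_act_one)
  qed
  then have Bij: "GL_act T \<in> Bij UNIV" if "T \<in> carrier GL_mat"
    for T :: "'a::field^'n^'n \<Rightarrow> 'a^'n^'n"
    using that by (simp add: Bij_def)
  then show ?thesis
    unfolding group_action_def group_hom_def group_hom_axioms_def
  proof (intro conjI group_GL_mat group_BijGroup homI)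
    fix S T :: "'a^'n^'n \<Rightarrow> 'a^'n^'n"
    assume ST: "S \<in> carrier GL_mat" "T \<in> carrier GL_mat"
    then show "GL_act (S \<otimes>\<^bsub>GL_mat\<^esub> T) = GL_act S \<otimes>\<^bsub>BijGroup UNIV\<^esub> GL_act T"
      by (simp add: BijGroup_def Bij fun_eq_iff compose_def GL_act_mult)
  qed (simp add: BijGroup_def)
qed

lemma subgroup_Stab: "subgroup (Stab f) GL_mat"
  by (rule group_action.stabilizer_subgroup [OF group_action_GL_act UNIV_I])

end

theory Submission
  imports Defs "HOL-Computational_Algebra.Polynomial"
begin

text \<open>
  Call \<open>E\<close> an affine direction of \<open>f\<close> if \<open>t \<mapsto> f (X + t E)\<close> is affine for every \<open>X\<close>. This notion
  is preserved by every linear automorphism that fixes \<open>f\<close>. The affine directions of the determinant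
  are the matrices of rank at most one, a large and irreducible family; those of a generalized
  determinant with \<open>\<alpha>\<^sup>2 \<noteq> \<beta>\<^sup>2\<close> are only the matrices supported in a single row or a single column
  (\<open>affine_along_gen_det_iff\<close>). Indeed, the coefficient of \<open>t\<^sup>2\<close> at a partial permutation matrix
  \<open>X\<close> with rows \<open>i, k\<close> and columns \<open>j, l\<close> deleted is a combination of \<open>E\<^sub>i\<^sub>j E\<^sub>k\<^sub>l\<close> and
  \<open>E\<^sub>i\<^sub>l E\<^sub>k\<^sub>j\<close> with coefficients \<open>\<alpha>, \<beta>\<close>, and the two coefficients change places when the parity of
  the partial permutation does. So both products vanish.

  A stabilizing automorphism \<open>T\<close> therefore permutes the maximal linear subspaces of this set of
  matrices, which are the \<open>n\<close> row spaces and the \<open>n\<close> column spaces. Two of these spaces intersect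
  trivially iff they are distinct and parallel, so, possibly after composing with the transposition of
  matrices, \<open>T\<close> maps rows to rows and columns to columns. Intersecting a row with a column shows
  that \<open>T\<close> permutes rows by \<open>\<sigma>\<close>, columns by \<open>\<tau>\<close> and rescales the entries by
  a matrix \<open>C\<close> without zero entries (\<open>preserves_cliques_cases\<close>).

  It remains to compare coefficients. The product \<open>\<Prod>\<^sub>i C\<^bsub>i,p i\<^esub>\<close> is constant on one parity class of
  permutations \<open>p\<close>, and for \<open>n \<ge> 5\<close> this forces it to be constant altogether
  (\<open>perm_prod_constant\<close>). If \<open>\<sigma>\<close> and \<open>\<tau>\<close> had different parities, the constant would
  interchange \<open>\<alpha>\<close> and \<open>\<beta>\<close>, contrary to \<open>\<alpha>\<^sup>2 \<noteq> \<beta>\<^sup>2\<close>. So the parities agree, the constant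
  is \<open>1\<close>, and \<open>T\<close> preserves every generalized determinant, in particular the determinant and the
  permanent. Conversely, these two span all generalized determinants.
\<close>

section \<open>Generalized determinants as weighted sums over permutations\<close>

abbreviation swap :: "'b \<Rightarrow> 'b \<Rightarrow> 'b \<Rightarrow> 'b" where
  "swap \<equiv> Transposition.transpose"

abbreviation mtranspose :: "'a^'n^'n \<Rightarrow> 'a^'n^'n" where
  "mtranspose \<equiv> Finite_Cartesian_Product.transpose"

definition parity_weight :: "'a \<Rightarrow> 'a \<Rightarrow> ('n \<Rightarrow> 'n) \<Rightarrow> 'a" where
  "parity_weight \<alpha> \<beta> p = (if evenperm p then \<alpha> else \<beta>)"

definition perm_prod :: "'a::comm_ring_1^'n^'n \<Rightarrow> ('n \<Rightarrow> 'n) \<Rightarrow> 'a" where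
  "perm_prod A p = (\<Prod>i\<in>UNIV. A $ i $ p i)"

lemma gen_det_eq_sum:
  "gen_det \<alpha> \<beta> A = (\<Sum>p | p permutes UNIV. parity_weight \<alpha> \<beta> p * perm_prod A p)"
proof -
  have "(\<Sum>p | p permutes UNIV. parity_weight \<alpha> \<beta> p * perm_prod A p) =
      (\<Sum>p | p permutes UNIV. (if evenperm p then \<alpha> * (\<Prod>i\<in>UNIV. A $ i $ p i) else 0)
      + (if \<not> evenperm p then \<beta> * (\<Prod>i\<in>UNIV. A $ i $ p i) else 0))"
    by (intro sum.cong refl) (simp add: parity_weight_def perm_prod_def)
  also have "\<dots> = \<alpha> * even_det A + \<beta> * odd_det A"
    unfolding even_det_def odd_det_def sum.distrib
    by (simp add: sum.inter_filter [symmetric] sum_distrib_left)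
  finally show ?thesis by (simp add: gen_det_def)
qed

lemma evenperm_comp_permutes:
  fixes p q :: "'n::finite \<Rightarrow> 'n"
  assumes "p permutes UNIV" "q permutes UNIV"
  shows "evenperm (p \<circ> q) \<longleftrightarrow> evenperm p = evenperm q"
  by (rule evenperm_comp) (use assms in \<open>auto intro: permutes_imp_permutation [OF finite]\<close>)

lemma evenperm_inv_permutes:
  fixes p :: "'n::finite \<Rightarrow> 'n"
  assumes "p permutes UNIV"
  shows "evenperm (Hilbert_Choice.inv p) = evenperm p"
  by (rule evenperm_inv) (use assms in \<open>auto intro: permutes_imp_permutation [OF finite]\<close>)

lemma comp_swap_permutes: "p permutes UNIV \<Longrightarrow> p \<circ> swap a b permutes UNIV"
  by (intro permutes_compose permutes_swap_id) auto

lemma evenperm_comp_swap: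
  fixes p :: "'n::finite \<Rightarrow> 'n"
  assumes "p permutes UNIV" "a \<noteq> b"
  shows "evenperm (p \<circ> swap a b) \<longleftrightarrow> \<not> evenperm p"
  using assms by (subst evenperm_comp_permutes) (auto simp: evenperm_swap intro: permutes_swap_id)

lemma gen_det_transpose:
  "gen_det \<alpha> \<beta> (mtranspose A) = gen_det \<alpha> \<beta> A"
proof -
  have "parity_weight \<alpha> \<beta> (Hilbert_Choice.inv p)
      * perm_prod (mtranspose A) (Hilbert_Choice.inv p)
      = parity_weight \<alpha> \<beta> p * perm_prod A p" if p: "p permutes UNIV" for p
  proof -
    have "perm_prod (mtranspose A) (Hilbert_Choice.inv p)
        = (\<Prod>i\<in>UNIV. A $ (Hilbert_Choice.inv p i) $ i)"
      by (simp add: perm_prod_def Finite_Cartesian_Product.transpose_def)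
    also have "\<dots> = perm_prod A p"
      unfolding perm_prod_def
      by (subst prod.permute [OF p]) (simp add: o_def permutes_inverses [OF p])
    finally show ?thesis
      by (simp add: parity_weight_def evenperm_inv_permutes [OF p])
  qed
  then show ?thesis
    unfolding gen_det_eq_sum by (subst sum_permutations_inverse) (rule sum.cong, auto)
qed

lemma perm_prod_split_pair:
  assumes "i \<noteq> k"
  shows "perm_prod A p = A $ i $ p i * A $ k $ p k * (\<Prod>m\<in>-{i,k}. A $ m $ p m)"
proof -
  have "UNIV = insert i (insert k (-{i,k}))" by auto
  then have "perm_prod A p = (\<Prod>m\<in>insert i (insert k (-{i,k})). A $ m $ p m)"
    unfolding perm_prod_def by metis
  then show ?thesis using assms by (simp add: mult.assoc)
qed

lemma ex_distinct_from:
  assumes "finite S" "card S < CARD('n)"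
  shows "\<exists>x::'n::finite. x \<notin> S"
  by (metis assms UNIV_eq_I card.infinite finite less_irrefl)

lemma swap_apply_third [simp]: "x \<noteq> a \<Longrightarrow> x \<noteq> b \<Longrightarrow> swap a b x = x"
  by (rule transpose_apply_other)

section \<open>Diagonal products that are constant on one parity class\<close>

text \<open>The factor by which a diagonal product changes when the values \<open>j\<close> and \<open>l\<close> of a permutation
  at \<open>i\<close> and \<open>k\<close> are interchanged. For fixed \<open>i\<close> and \<open>k\<close> it is a multiplicative cocycle in \<open>j, l\<close>.\<close>

definition cross_ratio :: "'a::field^'n^'n \<Rightarrow> 'n \<Rightarrow> 'n \<Rightarrow> 'n \<Rightarrow> 'n \<Rightarrow> 'a" where
  "cross_ratio C i k j l = C $ i $ l * C $ k $ j / (C $ i $ j * C $ k $ l)"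

lemma perm_prod_comp_swap:
  assumes "\<And>i j. C $ i $ j \<noteq> 0" "i \<noteq> k"
  shows "perm_prod C (p \<circ> swap i k) = perm_prod C p * cross_ratio C i k (p i) (p k)"
proof -
  have "(\<Prod>m\<in>-{i,k}. C $ m $ (p \<circ> swap i k) m) = (\<Prod>m\<in>-{i,k}. C $ m $ p m)"
    by (rule prod.cong) auto
  then show ?thesis
    using assms by (simp add: perm_prod_split_pair [OF assms(2)] cross_ratio_def)
qed

lemma perm_prod_nonzero:
  assumes "\<And>i j. C $ i $ j \<noteq> (0::'a::field)"
  shows "perm_prod C p \<noteq> 0"
  using assms by (simp add: perm_prod_def)

text \<open>Inverse pairs placed around a cycle of length five: along an odd cycle each element becomes its
  own inverse.\<close>

lemma odd_cycle_of_inverses: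
  fixes u :: "'a::field"
  assumes "u * v = 1" "v * w = 1" "w * x = 1" "x * y = 1" "y * u = 1"
  shows "u ^ 2 = 1" "u = v"
proof -
  have "v \<noteq> 0" "x \<noteq> 0" using assms by auto
  have "u = w" using assms(1,2) \<open>v \<noteq> 0\<close> by (metis mult.commute mult_cancel_right)
  moreover have "w = y" using assms(3,4) \<open>x \<noteq> 0\<close> by (metis mult.commute mult_cancel_right)
  ultimately show "u ^ 2 = 1" using assms(5) by (simp add: power2_eq_square)
  then show "u = v" using assms(1) by (metis mult_cancel_left power2_eq_square mult_zero_left zero_neq_one)
qed

text \<open>Two disjoint row transpositions together keep the parity, so their factors are mutually inverse.
  Five rows contain a cycle of five consecutively disjoint pairs (the Petersen graph has odd cycles),
  so all factors belonging to \<open>p\<close> equal some \<open>x\<close> with \<open>x\<^sup>2 = 1\<close>. Rotating the values of \<open>p\<close> at three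
  rows keeps the parity and keeps the factor of the pair formed by two other rows, so the same \<open>x\<close>
  belongs to all three rotated permutations; the cocycle identity gives \<open>x\<^sup>3 = 1\<close>, whence \<open>x = 1\<close>.\<close>

lemma cross_ratio_eq_1:
  fixes C :: "'a::field^'n^'n"
  assumes n: "CARD('n) \<ge> 5"
    and C: "\<And>i j. C $ i $ j \<noteq> 0"
    and const: "\<And>p. p permutes UNIV \<Longrightarrow> evenperm p = s \<Longrightarrow> perm_prod C p = \<delta>"
    and p: "p permutes UNIV" "evenperm p = s"
    and ab: "a \<noteq> b"
  shows "cross_ratio C a b (p a) (p b) = 1"
proof -
  define R where "R p i k = cross_ratio C i k (p i) (p k)" for p i k
  have \<delta>: "\<delta> \<noteq> 0" using const [OF p] perm_prod_nonzero [of C p] C by auto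
  have disjoint: "R p a b * R p c d = 1"
    if "p permutes UNIV" "evenperm p = s" "distinct [a, b, c, d]" for p a b c d
  proof -
    have "perm_prod C (p \<circ> swap a b \<circ> swap c d) = \<delta>"
      using that
      by (intro const comp_swap_permutes) (auto simp: evenperm_comp_swap comp_swap_permutes)
    also have "perm_prod C (p \<circ> swap a b \<circ> swap c d) = \<delta> * R p a b * R p c d"
      using that C by (auto simp: perm_prod_comp_swap R_def const)
    finally show ?thesis using \<delta> by simp
  qed
  have pairs: "(R p a b)\<^sup>2 = 1 \<and> R p a b = R p c d"
    if "p permutes UNIV" "evenperm p = s" "distinct [a, b, c, d, e]" for p a b c d e
  proof -
    have "R p a b * R p c d = 1" "R p c d * R p e a = 1" "R p e a * R p b c = 1"
      "R p b c * R p d e = 1" "R p d e * R p a b = 1"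
      by (rule disjoint [OF that(1,2)], use that(3) in auto)+
    then show ?thesis using odd_cycle_of_inverses by metis
  qed
  obtain c where c: "c \<notin> {a, b}"
    using ex_distinct_from [of "{a, b}"] ab n by auto
  obtain d where d: "d \<notin> {a, b, c}"
    using ex_distinct_from [of "{a, b, c}"] ab c n by auto
  obtain e where e: "e \<notin> {a, b, c, d}"
    using ex_distinct_from [of "{a, b, c, d}"] ab c d n by auto
  \<comment> \<open>\<open>rot\<close> moves the values at \<open>a, b, c\<close> cyclically and fixes those at \<open>d, e\<close>.\<close>
  define rot where "rot p = p \<circ> swap a b \<circ> swap b c" for p :: "'n \<Rightarrow> 'n"
  have rot: "rot q permutes UNIV" "evenperm (rot q) = s" if "q permutes UNIV" "evenperm q = s" for q
    using that ab c by (auto simp: rot_def evenperm_comp_swap comp_swap_permutes)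
  have rot_apply: "rot q a = q b" "rot q b = q c" "rot q c = q a" "rot q d = q d" "rot q e = q e" for q
    using ab c d e by (auto simp: rot_def)
  have de: "R (rot q) d e = R q d e" for q by (simp add: R_def rot_apply)
  have ab_de: "(R q a b)\<^sup>2 = 1 \<and> R q a b = R q d e" if "q permutes UNIV" "evenperm q = s" for q
    using pairs [OF that, of a b d e c] ab c d e by auto
  let ?x = "R p a b"
  have "R (rot p) a b = ?x" "R (rot (rot p)) a b = ?x"
    using ab_de p rot de by metis+
  moreover have "R p a b * R (rot p) a b * R (rot (rot p)) a b = 1"
    using C by (simp add: R_def rot_apply cross_ratio_def)
  ultimately have "?x * ?x * ?x = 1" by simp
  moreover have "?x * ?x = 1" using ab_de [OF p] unfolding power2_eq_square by (rule conjunct1)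
  ultimately have "?x = 1" by simp
  then show ?thesis by (simp add: R_def)
qed

text \<open>A permutation outside the class is one transposition away from the class.\<close>

lemma perm_prod_constant:
  fixes C :: "'a::field^'n^'n"
  assumes n: "CARD('n) \<ge> 5"
    and C: "\<And>i j. C $ i $ j \<noteq> 0"
    and const: "\<And>p. p permutes UNIV \<Longrightarrow> evenperm p = s \<Longrightarrow> perm_prod C p = \<delta>"
    and q: "q permutes UNIV"
  shows "perm_prod C q = \<delta>"
proof (cases "evenperm q = s")
  case False
  obtain a b :: 'n where ab: "a \<noteq> b"
    using ex_distinct_from [of "{undefined :: 'n}"] n by auto
  define p where "p = q \<circ> swap a b"
  have p: "p permutes UNIV" "evenperm p = s"
    using False q ab by (auto simp: p_def evenperm_comp_swap comp_swap_permutes)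
  have "q = p \<circ> swap a b" by (simp add: p_def comp_assoc)
  then have "perm_prod C q = perm_prod C p * cross_ratio C a b (p a) (p b)"
    using perm_prod_comp_swap [OF C ab] by simp
  then show ?thesis
    using const [OF p] cross_ratio_eq_1 [OF n C const p ab] by simp
qed (use const q in auto)

section \<open>Directions along which a generalized determinant is affine\<close>

definition supp :: "'a::zero^'n^'n \<Rightarrow> ('n \<times> 'n) set" where
  "supp A = {(i, j). A $ i $ j \<noteq> 0}"

text \<open>Positions are thought of as squares of a chessboard; two squares are adjacent if a rook on one
  attacks the other.\<close>

definition rook_clique :: "('n \<times> 'n) set \<Rightarrow> bool" where
  "rook_clique S \<longleftrightarrow> (\<forall>(i, j)\<in>S. \<forall>(k, l)\<in>S. i = k \<or> j = l)"

abbreviation row_line :: "'n \<Rightarrow> ('n \<times> 'n) set" where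
  "row_line i \<equiv> {i} \<times> UNIV"

abbreviation col_line :: "'n \<Rightarrow> ('n \<times> 'n) set" where
  "col_line j \<equiv> UNIV \<times> {j}"

definition lines :: "('n \<times> 'n) set set" where
  "lines = range row_line \<union> range col_line"

lemma rook_cliqueD: "rook_clique S \<Longrightarrow> (i, j) \<in> S \<Longrightarrow> (k, l) \<in> S \<Longrightarrow> i = k \<or> j = l"
  unfolding rook_clique_def by blast

text \<open>Two squares in the same row leave no room for a clique square outside that row, since it would
  have to lie in two columns at once; so a clique that leaves a row is confined to a column.\<close>

lemma rook_clique_iff_line: "rook_clique S \<longleftrightarrow> (\<exists>L\<in>lines. S \<subseteq> L)"
proof
  assume S: "rook_clique S"
  show "\<exists>L\<in>lines. S \<subseteq> L"
  proof (cases "S = {}")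
    case False
    then obtain i j where ij: "(i, j) \<in> S" by auto
    show ?thesis
    proof (cases "S \<subseteq> row_line i")
      case False
      then obtain k l where kl: "(k, l) \<in> S" "k \<noteq> i" by auto
      have "S \<subseteq> col_line j"
      proof (clarsimp)
        fix m o' assume "(m, o') \<in> S"
        then show "o' = j"
          using rook_cliqueD [OF S] ij kl by metis
      qed
      then show ?thesis unfolding lines_def by blast
    qed (auto simp: lines_def)
  qed (auto simp: lines_def)
qed (auto simp: rook_clique_def lines_def; blast)

text \<open>An affine function of \<open>t\<close> is determined by its values at \<open>0\<close> and \<open>1\<close>. Writing it through these
  values makes the condition linear in \<open>f\<close>, so it may be checked on the monomials of \<open>f\<close>.\<close>

definition affine_along :: "('a::field^'n^'n \<Rightarrow> 'a) \<Rightarrow> 'a^'n^'n \<Rightarrow> bool" where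
  "affine_along f E \<longleftrightarrow> (\<forall>X t. f (X + mat_scale t E) = f X + t * (f (X + E) - f X))"

text \<open>A permutation meets a row or a column exactly once, so only one factor of the product moves.\<close>

lemma perm_prod_affine:
  assumes "rook_clique (supp E)" and q: "q permutes UNIV"
  shows "perm_prod (X + mat_scale t E) q
    = perm_prod X q + t * (perm_prod (X + E) q - perm_prod X q)"
proof -
  have "\<exists>m. \<forall>i. i \<noteq> m \<longrightarrow> E $ i $ q i = 0"
  proof -
    have "q i = q k \<longleftrightarrow> i = k" for i k using permutes_inj [OF q] by (auto dest: injD)
    then have "E $ i $ q i = 0 \<or> E $ k $ q k = 0" if "i \<noteq> k" for i k
      using rook_cliqueD [OF assms(1), of i "q i" k "q k"] that by (auto simp: supp_def)
    then show ?thesis by metis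
  qed
  then obtain m where m: "\<And>i. i \<noteq> m \<Longrightarrow> E $ i $ q i = 0" by auto
  have split: "perm_prod (X + mat_scale r E) q
      = (X $ m $ q m + r * E $ m $ q m) * (\<Prod>i\<in>UNIV-{m}. X $ i $ q i)" for r
  proof -
    have "(\<Prod>i\<in>UNIV-{m}. (X + mat_scale r E) $ i $ q i) = (\<Prod>i\<in>UNIV-{m}. X $ i $ q i)"
      by (rule prod.cong) (auto simp: m mat_scale_def)
    then show ?thesis
      unfolding perm_prod_def by (subst prod.remove [of _ m]) (auto simp: mat_scale_def)
  qed
  have "X + mat_scale 0 E = X" "X + mat_scale 1 E = X + E"
    by (simp_all add: mat_scale_def vec_eq_iff)
  with split [of t] split [of 0] split [of 1] show ?thesis
    by (simp add: algebra_simps)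
qed

lemma affine_along_of_rook_clique:
  assumes "rook_clique (supp E)"
  shows "affine_along (gen_det \<alpha> \<beta>) E"
  unfolding affine_along_def
proof (intro allI)
  fix X t
  have "gen_det \<alpha> \<beta> (X + mat_scale t E) = (\<Sum>q | q permutes UNIV. parity_weight \<alpha> \<beta> q
      * (perm_prod X q + t * (perm_prod (X + E) q - perm_prod X q)))"
    unfolding gen_det_eq_sum by (rule sum.cong) (auto simp: perm_prod_affine [OF assms])
  also have "\<dots> = gen_det \<alpha> \<beta> X + t * (gen_det \<alpha> \<beta> (X + E) - gen_det \<alpha> \<beta> X)"
    unfolding gen_det_eq_sum sum_distrib_left sum_subtractf [symmetric] sum.distrib [symmetric]
    by (rule sum.cong) (auto simp: algebra_simps)
  finally show "gen_det \<alpha> \<beta> (X + mat_scale t E)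
    = gen_det \<alpha> \<beta> X + t * (gen_det \<alpha> \<beta> (X + E) - gen_det \<alpha> \<beta> X)" .
qed

lemma permutes_eq_off_pair:
  assumes p: "p permutes UNIV" and q: "q permutes UNIV" and "i \<noteq> k"
    and eq: "\<And>m. m \<notin> {i, k} \<Longrightarrow> q m = p m"
  shows "q = p \<or> q = p \<circ> swap i k"
proof -
  have inj: "p x = p y \<longleftrightarrow> x = y" "q x = q y \<longleftrightarrow> x = y" for x y
    using permutes_inj [OF p] permutes_inj [OF q] by (auto dest: injD)
  have "q x \<in> {p i, p k}" if "x \<in> {i, k}" for x
  proof -
    obtain y where y: "q x = p y" using permutes_surj [OF p] by (metis surjD)
    then have "y \<in> {i, k}" using eq [of y] inj(2) [of x y] that by fastforce
    then show ?thesis using y by auto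
  qed
  then have *: "q i = p i \<or> q i = p k" "q k = p i \<or> q k = p k" by auto
  have "q i \<noteq> q k" using inj \<open>i \<noteq> k\<close> by auto
  with * consider "q i = p i" "q k = p k" | "q i = p k" "q k = p i" by metis
  then show ?thesis
  proof cases
    case 1
    have "q x = p x" for x
      using 1 eq [of x] by (cases "x = i"; cases "x = k") auto
    then show ?thesis by auto
  next
    case 2
    have "q x = (p \<circ> swap i k) x" for x
      using 2 eq [of x] by (cases "x = i"; cases "x = k") auto
    then show ?thesis by auto
  qed
qed

text \<open>The coefficient of \<open>t\<^sup>2\<close> in \<open>gen_det \<alpha> \<beta> (P + t E)\<close>, where \<open>P\<close> is the permutation matrix of \<open>p\<close>
  with rows \<open>i\<close> and \<open>k\<close> deleted. These zero rows already account for two factors \<open>t\<close>, so the other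
  factors must come from \<open>P\<close>, which leaves only the permutations agreeing with \<open>p\<close> off \<open>{i, k}\<close>.\<close>

lemma two_rook_relation:
  fixes E :: "'a::field_char_0^'n^'n"
  assumes aff: "affine_along (gen_det \<alpha> \<beta>) E" and p: "p permutes UNIV" and ik: "i \<noteq> k"
  shows "parity_weight \<alpha> \<beta> p * (E $ i $ p i * E $ k $ p k)
    + parity_weight \<beta> \<alpha> p * (E $ i $ p k * E $ k $ p i) = 0"
proof -
  define P :: "'a^'n^'n" where "P = (\<chi> m l. if m \<notin> {i, k} \<and> l = p m then 1 else 0)"
  define h where "h q = (\<Prod>m\<in>UNIV. [:P $ m $ q m, E $ m $ q m:])" for q
  define g where "g = (\<Sum>q | q permutes UNIV. smult (parity_weight \<alpha> \<beta> q) (h q))"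
  have "poly g t = gen_det \<alpha> \<beta> (P + mat_scale t E)" for t
    unfolding g_def h_def gen_det_eq_sum perm_prod_def poly_sum poly_smult poly_prod
    by (simp add: mat_scale_def)
  then have "poly g = poly [:gen_det \<alpha> \<beta> P, gen_det \<alpha> \<beta> (P + E) - gen_det \<alpha> \<beta> P:]"
    using aff unfolding affine_along_def by (auto simp: fun_eq_iff)
  then have "g = [:gen_det \<alpha> \<beta> P, gen_det \<alpha> \<beta> (P + E) - gen_det \<alpha> \<beta> P:]"
    by (simp only: poly_eq_poly_eq_iff)
  then have "coeff g 2 = 0" by (simp add: numeral_2_eq_2)
  moreover have "coeff (h q) 2 = E $ i $ q i * E $ k $ q k
      * (if \<forall>m. m \<notin> {i, k} \<longrightarrow> q m = p m then 1 else 0)" for q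
  proof -
    let ?r = "\<Prod>m\<in>-{i,k}. [:P $ m $ q m, E $ m $ q m:]"
    have "UNIV = insert i (insert k (-{i,k}))" by auto
    then have "h q = (\<Prod>m\<in>insert i (insert k (-{i,k})). [:P $ m $ q m, E $ m $ q m:])"
      unfolding h_def by metis
    also have "\<dots> = [:0, E $ i $ q i:] * ([:0, E $ k $ q k:] * ?r)"
      using ik by (simp add: P_def)
    also have "\<dots> = Polynomial.monom (E $ i $ q i * E $ k $ q k) 2 * ?r"
      by (simp add: monom_altdef numeral_2_eq_2 mult.commute)
    finally have "coeff (h q) 2 = E $ i $ q i * E $ k $ q k * coeff ?r 0"
      by (simp add: coeff_monom_mult)
    also have "coeff ?r 0 = (\<Prod>m\<in>-{i,k}. if q m = p m then 1 else 0)"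
      by (auto simp: poly_0_coeff_0 [symmetric] poly_prod P_def intro!: prod.cong)
    also have "\<dots> = (if \<forall>m. m \<notin> {i, k} \<longrightarrow> q m = p m then 1 else 0)"
      by (auto intro!: prod.neutral prod_zero)
    finally show ?thesis .
  qed
  ultimately have "0 = (\<Sum>q | q permutes UNIV. parity_weight \<alpha> \<beta> q * (E $ i $ q i * E $ k $ q k
      * (if \<forall>m. m \<notin> {i, k} \<longrightarrow> q m = p m then 1 else 0)))"
    by (simp add: g_def coeff_sum)
  also have "\<dots> = (\<Sum>q\<in>{p, p \<circ> swap i k}. parity_weight \<alpha> \<beta> q * (E $ i $ q i * E $ k $ q k
      * (if \<forall>m. m \<notin> {i, k} \<longrightarrow> q m = p m then 1 else 0)))"
    using p permutes_eq_off_pair [OF p _ ik]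
    by (intro sum.mono_neutral_right) (auto simp: comp_swap_permutes)
  also have "\<dots> = parity_weight \<alpha> \<beta> p * (E $ i $ p i * E $ k $ p k)
      + parity_weight \<alpha> \<beta> (p \<circ> swap i k) * (E $ i $ p k * E $ k $ p i)"
  proof -
    have "p \<noteq> p \<circ> swap i k"
      using evenperm_comp_swap [OF p ik] by metis
    then show ?thesis by simp
  qed
  also have "parity_weight \<alpha> \<beta> (p \<circ> swap i k) = parity_weight \<beta> \<alpha> p"
    by (simp add: parity_weight_def evenperm_comp_swap [OF p ik])
  finally show ?thesis by simp
qed

lemma ex_permutes_pair:
  fixes i k j l :: 'n
  assumes "i \<noteq> k" "j \<noteq> l"
  obtains p where "p permutes UNIV" "p i = j" "p k = l"
proof
  let ?p = "swap (swap i j k) l \<circ> swap i j"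
  have "swap i j k \<noteq> j" using assms by (metis transpose_apply_first transpose_involutory)
  then show "?p i = j" "?p k = l" using assms by auto
  show "?p permutes UNIV" by (intro permutes_compose permutes_swap_id) auto
qed

text \<open>A fourth row and column leave room to change the parity of \<open>p\<close> without changing \<open>p i\<close> and \<open>p k\<close>.
  The two resulting relations form a linear system with matrix \<open>((\<alpha>, \<beta>), (\<beta>, \<alpha>))\<close> and determinant
  \<open>\<alpha>\<^sup>2 - \<beta>\<^sup>2 \<noteq> 0\<close>.\<close>

lemma affine_along_gen_det_iff:
  fixes E :: "'a::field_char_0^'n^'n"
  assumes n: "CARD('n) \<ge> 4" and "\<alpha> \<noteq> \<beta>" "\<alpha> \<noteq> - \<beta>"
  shows "affine_along (gen_det \<alpha> \<beta>) E \<longleftrightarrow> rook_clique (supp E)"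
proof
  assume aff: "affine_along (gen_det \<alpha> \<beta>) E"
  have "E $ i $ j * E $ k $ l = 0" if ik: "i \<noteq> k" and jl: "j \<noteq> l" for i j k l
  proof -
    obtain p where p: "p permutes UNIV" "p i = j" "p k = l"
      using ex_permutes_pair [OF ik jl] .
    obtain c where c: "c \<notin> {i, k}"
      using ex_distinct_from [of "{i, k}"] ik n by auto
    obtain d where d: "d \<notin> {i, k, c}"
      using ex_distinct_from [of "{i, k, c}"] ik c n by auto
    define q where "q = p \<circ> swap c d"
    have q: "q permutes UNIV" "q i = j" "q k = l" and odd: "evenperm q \<longleftrightarrow> \<not> evenperm p"
      using p c d by (auto simp: q_def comp_swap_permutes evenperm_comp_swap)
    let ?u = "E $ i $ j * E $ k $ l" and ?v = "E $ i $ l * E $ k $ j"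
    have "\<alpha> * ?u + \<beta> * ?v = 0 \<and> \<beta> * ?u + \<alpha> * ?v = 0"
      using two_rook_relation [OF aff p(1) ik] two_rook_relation [OF aff q(1) ik]
      unfolding p(2,3) q(2,3) parity_weight_def odd by (cases "evenperm p") auto
    then have "(\<alpha> - \<beta>) * (\<alpha> + \<beta>) * ?u = 0" by algebra
    then show ?thesis using assms(2,3) by (auto simp: eq_neg_iff_add_eq_0)
  qed
  then show "rook_clique (supp E)"
    unfolding rook_clique_def supp_def by (auto simp: mult_eq_0_iff)
qed (rule affine_along_of_rook_clique)

section \<open>Linear automorphisms that preserve rook cliques\<close>

definition supported_on :: "('n \<times> 'n) set \<Rightarrow> ('a::zero^'n^'n) set" where
  "supported_on S = {A. supp A \<subseteq> S}"

lemma supported_on_iff: "A \<in> supported_on S \<longleftrightarrow> (\<forall>i j. (i, j) \<notin> S \<longrightarrow> A $ i $ j = 0)"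
  unfolding supported_on_def supp_def by blast

definition preserves_cliques :: "('a::field^'n^'n \<Rightarrow> 'a^'n^'n) \<Rightarrow> bool" where
  "preserves_cliques T \<longleftrightarrow> T \<in> carrier GL_mat \<and>
    (\<forall>E. rook_clique (supp (T E)) \<longleftrightarrow> rook_clique (supp E))"

lemma GL_mat_add: "T \<in> carrier GL_mat \<Longrightarrow> T (X + Y) = T X + T Y"
  by (simp add: GL_mat_def linear_mat_scale_iff)

lemma GL_mat_scale: "T \<in> carrier GL_mat \<Longrightarrow> T (mat_scale c X) = mat_scale c (T X)"
  by (simp add: GL_mat_def linear_mat_scale_iff)

lemma GL_mat_zero: "T \<in> carrier GL_mat \<Longrightarrow> T 0 = 0"
  using GL_mat_add [of T 0 0] by simp

lemma GL_mat_sum: "T \<in> carrier GL_mat \<Longrightarrow> T (sum g A) = (\<Sum>x\<in>A. T (g x))"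
  by (induction A rule: infinite_finite_induct) (simp_all add: GL_mat_zero GL_mat_add)

lemma GL_mat_inj: "T \<in> carrier GL_mat \<Longrightarrow> inj T"
  by (simp add: GL_mat_def bij_is_inj)

lemma affine_along_invariant:
  assumes T: "T \<in> carrier GL_mat" and f: "\<And>X. f (T X) = f X"
  shows "affine_along f (T E) \<longleftrightarrow> affine_along f E"
proof -
  have "surj T" using T by (simp add: GL_mat_def bij_is_surj)
  then have "affine_along f (T E) \<longleftrightarrow>
      (\<forall>Y t. f (T Y + mat_scale t (T E)) = f (T Y) + t * (f (T Y + T E) - f (T Y)))"
    unfolding affine_along_def by (metis surjD)
  also have "\<dots> \<longleftrightarrow> affine_along f E"
    unfolding affine_along_def
    by (simp add: f GL_mat_add [OF T, symmetric] GL_mat_scale [OF T, symmetric])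
  finally show ?thesis .
qed

lemma preserves_cliques_inv:
  assumes "preserves_cliques T"
  shows "preserves_cliques (inv\<^bsub>GL_mat\<^esub> T)"
  using assms group.inv_closed [OF group_GL_mat] inv_GL_mat_cancel
  unfolding preserves_cliques_def by metis

lemma supp_unit: "supp (axis i (axis j (1::'a::zero_neq_one))) = {(i, j)}"
  by (auto simp: supp_def axis_def split: if_splits)

lemma supported_on_mono_iff:
  "supported_on S \<subseteq> (supported_on S' :: ('a::zero_neq_one^'n^'n) set) \<longleftrightarrow> S \<subseteq> S'"
proof
  assume sub: "supported_on S \<subseteq> (supported_on S' :: ('a^'n^'n) set)"
  show "S \<subseteq> S'"
  proof
    fix x assume "x \<in> S"
    then have "axis (fst x) (axis (snd x) (1::'a)) \<in> supported_on S"
      by (simp add: supported_on_def supp_unit)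
    then have "axis (fst x) (axis (snd x) (1::'a)) \<in> supported_on S'" using sub by blast
    then show "x \<in> S'" by (simp add: supported_on_def supp_unit)
  qed
qed (auto simp: supported_on_def)

text \<open>Every matrix in the image is supported in a line; a common line is needed. The set \<open>U\<close> of all
  positions occupied by some image matrix is itself a clique: if two positions are occupied by
  \<open>T A\<close> and \<open>T B\<close>, then one of \<open>T A\<close>, \<open>T B\<close>, \<open>T A + T B\<close> occupies both.\<close>

lemma image_line_subset:
  fixes T :: "'a::field^'n^'n \<Rightarrow> 'a^'n^'n"
  assumes T: "preserves_cliques T" and L: "L \<in> lines"
  shows "\<exists>L'\<in>lines. T ` supported_on L \<subseteq> supported_on L'"
proof -
  have Tc: "T \<in> carrier GL_mat" using T by (simp add: preserves_cliques_def)
  have clique: "rook_clique (supp (T A))" if "A \<in> supported_on L" for A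
    using T L that unfolding preserves_cliques_def supported_on_def rook_clique_iff_line by auto
  have add: "A + B \<in> supported_on L" if "A \<in> supported_on L" "B \<in> supported_on L" for A B :: "'a^'n^'n"
    using that by (simp add: supported_on_iff)
  define U where "U = (\<Union>A\<in>supported_on L. supp (T A))"
  have "rook_clique U"
    unfolding rook_clique_def
  proof (clarify)
    fix i j k l assume ij: "(i, j) \<in> U" and kl: "(k, l) \<in> U" and "j \<noteq> l"
    obtain A B where A: "A \<in> supported_on L" "(i, j) \<in> supp (T A)"
      and B: "B \<in> supported_on L" "(k, l) \<in> supp (T B)"
      using ij kl by (auto simp: U_def)
    have "\<exists>D\<in>supported_on L. (i, j) \<in> supp (T D) \<and> (k, l) \<in> supp (T D)"
    proof (cases "(k, l) \<in> supp (T A) \<or> (i, j) \<in> supp (T B)")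
      case False
      then have "(i, j) \<in> supp (T (A + B)) \<and> (k, l) \<in> supp (T (A + B))"
        using A B by (simp add: GL_mat_add [OF Tc] supp_def)
      then show ?thesis using add A B by blast
    qed (use A B in auto)
    then show "i = k" using rook_cliqueD [OF clique] \<open>j \<noteq> l\<close> by blast
  qed
  then obtain L' where "L' \<in> lines" "U \<subseteq> L'" unfolding rook_clique_iff_line by blast
  then show ?thesis by (auto simp: U_def supported_on_def)
qed

lemma line_subset_line:
  fixes L :: "('n::finite \<times> 'n) set"
  assumes "CARD('n) \<ge> 2" "L \<in> lines" "L' \<in> lines" "L \<subseteq> L'"
  shows "L = L'"
proof -
  have other: "\<exists>y::'n. y \<noteq> x" for x using ex_distinct_from [of "{x}"] assms(1) by auto
  have "\<not> row_line i \<subseteq> col_line j" "\<not> col_line j \<subseteq> row_line i" for i j :: 'n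
    using other [of i] other [of j] by auto
  moreover have "row_line i \<subseteq> row_line k \<longleftrightarrow> i = k" "col_line i \<subseteq> col_line k \<longleftrightarrow> i = k" for i k :: 'n
    by auto
  ultimately show ?thesis using assms(2-) unfolding lines_def by blast
qed

text \<open>The inclusion for \<open>T\<close> followed by that for its inverse sends a line into a line, and no line
  properly contains another.\<close>

lemma image_line:
  fixes T :: "'a::field^'n^'n \<Rightarrow> 'a^'n^'n"
  assumes n: "CARD('n) \<ge> 2" and T: "preserves_cliques T" and L: "L \<in> lines"
  shows "\<exists>L'\<in>lines. T ` supported_on L = supported_on L'"
proof -
  let ?S = "inv\<^bsub>GL_mat\<^esub> T"
  have cancel: "?S (T X) = X" "T (?S X) = X" for X
    using T inv_GL_mat_cancel by (auto simp: preserves_cliques_def)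
  obtain L' where L': "L' \<in> lines" "T ` supported_on L \<subseteq> supported_on L'"
    using image_line_subset [OF T L] by blast
  obtain L'' where L'': "L'' \<in> lines" "?S ` supported_on L' \<subseteq> supported_on L''"
    using image_line_subset [OF preserves_cliques_inv [OF T] L'(1)] by blast
  have "supported_on L = ?S ` T ` supported_on L" by (simp add: image_comp o_def cancel)
  also have "\<dots> \<subseteq> supported_on L''" using L'(2) L''(2) by blast
  finally have "L = L''"
    using line_subset_line [OF n L L''(1)] by (simp add: supported_on_mono_iff)
  then have "T ` ?S ` supported_on L' \<subseteq> T ` supported_on L" using L''(2) by blast
  then have "supported_on L' \<subseteq> T ` supported_on L" by (simp add: image_comp o_def cancel)
  then show ?thesis using L' by blast
qed

definition monomial_map where
  "monomial_map \<sigma> \<tau> C T \<longleftrightarrow> \<sigma> permutes UNIV \<and> \<tau> permutes UNIV \<and> (\<forall>i j. C $ i $ j \<noteq> 0) \<and>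
    (\<forall>X i j. T X $ \<sigma> i $ \<tau> j = C $ i $ j * (X::'a::field^'n^'n) $ i $ j)"

lemma supported_on_Int: "supported_on (S \<inter> S') = supported_on S \<inter> supported_on S'"
  by (auto simp: supported_on_def)

lemma supported_on_eq_iff:
  "supported_on S = (supported_on S' :: ('a::zero_neq_one^'n^'n) set) \<longleftrightarrow> S = S'"
  using supported_on_mono_iff by (metis subset_antisym order_refl)

lemma matrix_eq_sum_units:
  fixes X :: "'a::field^'n^'n"
  shows "X = (\<Sum>(i, j)\<in>UNIV. mat_scale (X $ i $ j) (axis i (axis j 1)))"
proof -
  have "(\<Sum>(i, j)\<in>UNIV. mat_scale (X $ i $ j) (axis i (axis j 1))) $ k $ l = X $ k $ l" for k l
  proof -
    have "(\<Sum>(i, j)\<in>UNIV. mat_scale (X $ i $ j) (axis i (axis j 1))) $ k $ l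
        = (\<Sum>x\<in>UNIV. if x = (k, l) then X $ k $ l else 0)"
      unfolding sum_component by (rule sum.cong) (auto simp: mat_scale_def axis_def split: if_splits)
    then show ?thesis by simp
  qed
  then show ?thesis by (simp add: vec_eq_iff)
qed

text \<open>The matrix unit at \<open>(i, j)\<close> lies in a row space and in a column space, so its image lies in the
  intersection of their images, which is spanned by the unit at \<open>(\<sigma> i, \<tau> j)\<close>.\<close>

lemma monomial_map_of_lines:
  fixes T :: "'a::field^'n^'n \<Rightarrow> 'a^'n^'n"
  assumes n: "CARD('n) \<ge> 2" and T: "T \<in> carrier GL_mat"
    and rows: "\<And>i. T ` supported_on (row_line i) = supported_on (row_line (\<sigma> i))"
    and cols: "\<And>j. T ` supported_on (col_line j) = supported_on (col_line (\<tau> j))"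
  shows "\<exists>C. monomial_map \<sigma> \<tau> C T"
proof -
  have inj: "T ` A = T ` B \<longleftrightarrow> A = B" for A B
    using GL_mat_inj [OF T] by (simp add: inj_image_eq_iff)
  have "inj \<sigma>"
  proof (rule injI)
    fix i k assume "\<sigma> i = \<sigma> k"
    then have "row_line i = row_line k" using rows inj by (metis supported_on_eq_iff)
    then show "i = k" by auto
  qed
  moreover have "inj \<tau>"
  proof (rule injI)
    fix i k assume "\<tau> i = \<tau> k"
    then have "col_line i = col_line k" using cols inj by (metis supported_on_eq_iff)
    then show "i = k" by auto
  qed
  ultimately have perm: "\<sigma> permutes UNIV" "\<tau> permutes UNIV"
    by (auto intro!: bij_imp_permutes simp: bij_def finite_UNIV_inj_surj)
  have unit: "supp (T (axis i (axis j 1))) \<subseteq> {(\<sigma> i, \<tau> j)}" for i j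
  proof -
    let ?E = "axis i (axis j (1::'a))"
    have "?E \<in> supported_on (row_line i)" "?E \<in> supported_on (col_line j)"
      by (simp_all add: supported_on_def supp_unit)
    then have "T ?E \<in> supported_on (row_line (\<sigma> i))" "T ?E \<in> supported_on (col_line (\<tau> j))"
      using rows cols by blast+
    then show ?thesis by (auto simp: supported_on_def)
  qed
  define C where "C = (\<chi> i j. T (axis i (axis j 1)) $ \<sigma> i $ \<tau> j)"
  have entry: "T (axis k (axis l 1)) $ \<sigma> i $ \<tau> j = (if (k, l) = (i, j) then C $ i $ j else 0)"
    for i j k l
    using unit [of k l] \<open>inj \<sigma>\<close> \<open>inj \<tau>\<close> by (auto simp: C_def supp_def dest: injD)
  have "C $ i $ j \<noteq> 0" for i j
  proof
    assume "C $ i $ j = 0"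
    then have "supp (T (axis i (axis j 1))) = {}"
      using unit [of i j] by (auto simp: C_def supp_def)
    then have "T (axis i (axis j 1)) = 0" by (auto simp: supp_def vec_eq_iff)
    then have "axis i (axis j (1::'a)) = 0"
      using GL_mat_zero [OF T] GL_mat_inj [OF T] by (metis injD)
    then show False using supp_unit [of i j, where 'a='a] by (simp add: supp_def)
  qed
  moreover have "T X $ \<sigma> i $ \<tau> j = C $ i $ j * X $ i $ j" for X i j
  proof -
    have "T X = (\<Sum>(k, l)\<in>UNIV. mat_scale (X $ k $ l) (T (axis k (axis l 1))))"
      by (subst matrix_eq_sum_units [of X])
        (simp add: GL_mat_sum [OF T] GL_mat_scale [OF T] case_prod_unfold)
    then have "T X $ \<sigma> i $ \<tau> j = (\<Sum>x\<in>UNIV. if x = (i, j) then C $ i $ j * X $ i $ j else 0)"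
      by (simp only: sum_component) (rule sum.cong, auto simp: mat_scale_def entry split: if_splits)
    then show ?thesis by simp
  qed
  ultimately show ?thesis using perm unfolding monomial_map_def by blast
qed

text \<open>Rows are the lines that are disjoint from, or equal to, a given row. Disjointness of lines is
  visible in the spaces they support, so once one row is sent to a row, all of them are; a column
  meets two distinct rows, hence its image does too and is a column.\<close>

lemma monomial_map_of_preserves_cliques:
  fixes T :: "'a::field^'n^'n \<Rightarrow> 'a^'n^'n"
  assumes n: "CARD('n) \<ge> 2" and T: "preserves_cliques T"
    and row: "T ` supported_on (row_line r) = supported_on (row_line r')"
  shows "\<exists>\<sigma> \<tau> C. monomial_map \<sigma> \<tau> C T"
proof -
  have Tc: "T \<in> carrier GL_mat" using T by (simp add: preserves_cliques_def)
  have meet: "L \<inter> M = {} \<longleftrightarrow> L' \<inter> M' = {}"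
    if "T ` supported_on L = supported_on L'" "T ` supported_on M = supported_on M'" for L L' M M'
  proof -
    have "T ` supported_on (L \<inter> M) = supported_on (L' \<inter> M')"
      using GL_mat_inj [OF Tc] by (simp add: supported_on_Int image_Int that)
    moreover have "supported_on {} = {0::'a^'n^'n}"
      by (auto simp: supported_on_def supp_def vec_eq_iff)
    moreover have "T ` A = {0} \<longleftrightarrow> A = {0}" for A
      using GL_mat_inj [OF Tc] GL_mat_zero [OF Tc]
      by (metis image_empty image_insert inj_image_eq_iff)
    ultimately show ?thesis by (metis supported_on_eq_iff)
  qed
  have "\<exists>k. T ` supported_on (row_line i) = supported_on (row_line k)" for i
  proof (cases "i = r")
    case False
    obtain L' where L': "L' \<in> lines" "T ` supported_on (row_line i) = supported_on L'"
      using image_line [OF n T, of "row_line i"] by (auto simp: lines_def)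
    have "row_line r' \<inter> L' = {}" using meet [OF row L'(2)] False by auto
    then have "L' \<in> range row_line" using L'(1) by (auto simp: lines_def)
    then show ?thesis using L'(2) by auto
  qed (use row in auto)
  then obtain \<sigma> where \<sigma>: "\<And>i. T ` supported_on (row_line i) = supported_on (row_line (\<sigma> i))"
    by metis
  have "\<exists>k. T ` supported_on (col_line j) = supported_on (col_line k)" for j
  proof -
    obtain L' where L': "L' \<in> lines" "T ` supported_on (col_line j) = supported_on L'"
      using image_line [OF n T, of "col_line j"] by (auto simp: lines_def)
    have L'_meets: "row_line (\<sigma> i) \<inter> L' \<noteq> {}" for i using meet [OF \<sigma> L'(2), of i] by auto
    obtain i :: 'n where i: "i \<noteq> r" using ex_distinct_from [of "{r}"] n by auto
    have "\<sigma> i \<noteq> \<sigma> r" using meet [OF \<sigma> [of i] \<sigma> [of r]] i by auto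
    then have "L' \<noteq> row_line k" for k using L'_meets [of i] L'_meets [of r] by auto
    then show ?thesis using L' by (auto simp: lines_def)
  qed
  then obtain \<tau> where \<tau>: "\<And>j. T ` supported_on (col_line j) = supported_on (col_line (\<tau> j))"
    by metis
  show ?thesis using monomial_map_of_lines [OF n Tc \<sigma> \<tau>] by blast
qed

lemma preserves_cliques_transpose:
  fixes T :: "'a::field^'n^'n \<Rightarrow> 'a^'n^'n"
  assumes "preserves_cliques T"
  shows "preserves_cliques (mtranspose \<circ> T)"
proof -
  have "bij (mtranspose :: 'a^'n^'n \<Rightarrow> 'a^'n^'n)"
    by (rule o_bij [where g = mtranspose]) (simp_all add: fun_eq_iff)
  then have "mtranspose \<circ> T \<in> carrier GL_mat"
    using assms bij_comp [of T mtranspose] unfolding preserves_cliques_def GL_mat_def linear_mat_scale_iff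
    by (auto simp: Finite_Cartesian_Product.transpose_def mat_scale_def vec_eq_iff)
  moreover have "rook_clique (supp (mtranspose A)) \<longleftrightarrow> rook_clique (supp A)" for A :: "'a^'n^'n"
    unfolding rook_clique_def supp_def Finite_Cartesian_Product.transpose_def by auto
  ultimately show ?thesis using assms by (simp add: preserves_cliques_def)
qed

lemma transpose_supported_on_col:
  "mtranspose ` supported_on (col_line j) = (supported_on (row_line j) :: ('a::zero^'n^'n) set)"
proof -
  have iff: "mtranspose A \<in> supported_on (row_line j) \<longleftrightarrow> A \<in> supported_on (col_line j)" for A :: "'a^'n^'n"
    by (auto simp: supported_on_def supp_def Finite_Cartesian_Product.transpose_def)
  have "B \<in> mtranspose ` supported_on (col_line j)" if "B \<in> supported_on (row_line j)" for B :: "'a^'n^'n"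
    using iff [of "mtranspose B"] that by (intro image_eqI [of _ _ "mtranspose B"]) simp_all
  then show ?thesis using iff by blast
qed

lemma preserves_cliques_cases:
  fixes T :: "'a::field^'n^'n \<Rightarrow> 'a^'n^'n"
  assumes n: "CARD('n) \<ge> 2" and T: "preserves_cliques T"
  obtains \<sigma> \<tau> C where "monomial_map \<sigma> \<tau> C T"
  | \<sigma> \<tau> C where "monomial_map \<sigma> \<tau> C (mtranspose \<circ> T)"
proof -
  fix r :: 'n
  obtain L' where L': "L' \<in> lines" "T ` supported_on (row_line r) = supported_on L'"
    using image_line [OF n T, of "row_line r"] by (auto simp: lines_def)
  consider k where "L' = row_line k" | k where "L' = col_line k"
    using L'(1) by (auto simp: lines_def)
  then show thesis
  proof cases
    case 1
    then show ?thesis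
      using monomial_map_of_preserves_cliques [OF n T] L'(2) that(1) by metis
  next
    case 2
    then have "(mtranspose \<circ> T) ` supported_on (row_line r) = supported_on (row_line k)"
      using L'(2) transpose_supported_on_col by (metis image_comp)
    then show ?thesis
      using monomial_map_of_preserves_cliques [OF n preserves_cliques_transpose [OF T]] that(2)
      by metis
  qed
qed

section \<open>Monomial maps preserving a generalized determinant\<close>

text \<open>Reindexing the sum by \<open>p \<mapsto> \<tau> \<circ> p \<circ> \<sigma>\<inverse>\<close>, which preserves parity iff \<open>\<sigma>\<close> and \<open>\<tau>\<close> have equal parity.\<close>

lemma gen_det_monomial_map:
  fixes T :: "'a::field^'n^'n \<Rightarrow> 'a^'n^'n"
  assumes "monomial_map \<sigma> \<tau> C T"
  shows "gen_det \<alpha> \<beta> (T X) = (\<Sum>p | p permutes UNIV.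
    (if evenperm p = (evenperm \<sigma> = evenperm \<tau>) then \<alpha> else \<beta>) * (perm_prod C p * perm_prod X p))"
proof -
  have \<sigma>: "\<sigma> permutes UNIV" and \<tau>: "\<tau> permutes UNIV"
    and T: "\<And>i j. T X $ \<sigma> i $ \<tau> j = C $ i $ j * X $ i $ j"
    using assms by (auto simp: monomial_map_def)
  let ?\<sigma>' = "Hilbert_Choice.inv \<sigma>"
  have \<sigma>': "?\<sigma>' permutes UNIV" by (rule permutes_inv [OF \<sigma>])
  have "gen_det \<alpha> \<beta> (T X) = (\<Sum>p | p permutes UNIV.
      parity_weight \<alpha> \<beta> (\<tau> \<circ> (p \<circ> ?\<sigma>')) * perm_prod (T X) (\<tau> \<circ> (p \<circ> ?\<sigma>')))"
    unfolding gen_det_eq_sum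
    by (subst setum_permutations_compose_left [OF \<tau>], subst sum_permutations_compose_right [OF \<sigma>'])
      (rule refl)
  also have "\<dots> = (\<Sum>p | p permutes UNIV.
    (if evenperm p = (evenperm \<sigma> = evenperm \<tau>) then \<alpha> else \<beta>) * (perm_prod C p * perm_prod X p))"
  proof (intro sum.cong refl arg_cong2 [where f = "(*)"])
    fix p :: "'n \<Rightarrow> 'n" assume "p \<in> {p. p permutes UNIV}"
    then have p: "p permutes UNIV" by simp
    have "evenperm (\<tau> \<circ> (p \<circ> ?\<sigma>')) \<longleftrightarrow> evenperm p = (evenperm \<sigma> = evenperm \<tau>)"
      using evenperm_comp_permutes [OF \<tau> permutes_compose [OF \<sigma>' p]]
        evenperm_comp_permutes [OF p \<sigma>'] evenperm_inv_permutes [OF \<sigma>] by auto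
    then show "parity_weight \<alpha> \<beta> (\<tau> \<circ> (p \<circ> ?\<sigma>'))
        = (if evenperm p = (evenperm \<sigma> = evenperm \<tau>) then \<alpha> else \<beta>)"
      by (simp add: parity_weight_def)
    have "perm_prod (T X) (\<tau> \<circ> (p \<circ> ?\<sigma>')) = (\<Prod>i\<in>UNIV. T X $ \<sigma> i $ \<tau> (p i))"
      unfolding perm_prod_def
      by (subst prod.permute [OF \<sigma>]) (simp add: o_def permutes_inverses [OF \<sigma>])
    also have "\<dots> = perm_prod C p * perm_prod X p"
      by (simp add: perm_prod_def T prod.distrib)
    finally show "perm_prod (T X) (\<tau> \<circ> (p \<circ> ?\<sigma>')) = perm_prod C p * perm_prod X p" .
  qed
  finally show ?thesis .
qed

lemma perm_prod_permutation_matrix: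
  "perm_prod (\<chi> i j. if j = p i then 1 else 0) q = (if q = p then 1 else 0)"
proof (cases "q = p")
  case False
  then obtain i where "q i \<noteq> p i" by auto
  then show ?thesis using False by (auto simp: perm_prod_def intro!: prod_zero)
qed (simp add: perm_prod_def)

text \<open>The monomials are linearly independent because each permutation matrix annihilates all of them
  but one.\<close>

lemma sum_perm_prod_coeff_unique:
  fixes u v :: "('n::finite \<Rightarrow> 'n) \<Rightarrow> 'a::comm_ring_1"
  assumes "\<And>X. (\<Sum>p | p permutes UNIV. u p * perm_prod X p)
      = (\<Sum>p | p permutes UNIV. v p * perm_prod X p)"
    and "p permutes UNIV"
  shows "u p = v p"
  using assms(1) [of "\<chi> i j. if j = p i then 1 else 0"] assms(2)
  by (simp add: perm_prod_permutation_matrix if_distrib [where f = "(*) _"] cong: if_cong)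

text \<open>Since \<open>\<alpha>\<close> and \<open>\<beta>\<close> do not both vanish, comparing coefficients pins down the diagonal products of \<open>C\<close>
  on a parity class \<open>s\<close> of nonzero weight, and thereby on all permutations. One of \<open>\<alpha>, \<beta>\<close> may be
  zero, in which case the other class carries no information of its own.\<close>

lemma monomial_map_preserves_all_gen_det:
  fixes T :: "'a::field^'n^'n \<Rightarrow> 'a^'n^'n"
  assumes n: "CARD('n) \<ge> 5" and "\<alpha> \<noteq> \<beta>" "\<alpha> \<noteq> - \<beta>"
    and T: "monomial_map \<sigma> \<tau> C T" and inv: "\<And>X. gen_det \<alpha> \<beta> (T X) = gen_det \<alpha> \<beta> X"
  shows "gen_det a b (T X) = gen_det a b X"
proof -
  have C: "C $ i $ j \<noteq> 0" for i j using T by (simp add: monomial_map_def)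
  define e where "e \<longleftrightarrow> evenperm \<sigma> = evenperm \<tau>"
  have coeff: "(if evenperm p = e then \<alpha> else \<beta>) * perm_prod C p = parity_weight \<alpha> \<beta> p"
    if "p permutes UNIV" for p
  proof (rule sum_perm_prod_coeff_unique [OF _ that])
    fix X
    show "(\<Sum>p | p permutes UNIV. (if evenperm p = e then \<alpha> else \<beta>) * perm_prod C p * perm_prod X p)
      = (\<Sum>p | p permutes UNIV. parity_weight \<alpha> \<beta> p * perm_prod X p)"
      using inv [of X] gen_det_monomial_map [OF T, of \<alpha> \<beta> X] gen_det_eq_sum [of \<alpha> \<beta> X]
      by (simp add: e_def mult.assoc)
  qed
  define w where "w s = (if s then \<alpha> else \<beta>)" for s
  have coeff: "w (evenperm p = e) * perm_prod C p = w (evenperm p)" if "p permutes UNIV" for p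
    using coeff [OF that] by (simp add: w_def parity_weight_def)
  obtain s where s: "w s \<noteq> 0"
    using \<open>\<alpha> \<noteq> \<beta>\<close> unfolding w_def by metis
  have "w (s = e) \<noteq> 0 \<and> (\<forall>p. p permutes UNIV \<longrightarrow> perm_prod C p = w s / w (s = e))"
  proof -
    obtain x y :: 'n where "x \<noteq> y"
      using ex_distinct_from [of "{undefined :: 'n}"] n by auto
    then have "evenperm (id :: 'n \<Rightarrow> 'n)" "\<not> evenperm (swap x y)"
      by (auto simp: evenperm_swap)
    then obtain p :: "'n \<Rightarrow> 'n" where "p permutes UNIV" "evenperm p = s"
      by (metis permutes_id permutes_swap_id UNIV_I)
    then have nz: "w (s = e) \<noteq> 0" using coeff [of p] s by auto
    have "perm_prod C p = w s / w (s = e)" if "p permutes UNIV" "evenperm p = s" for p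
      using coeff [OF that(1)] that(2) nz by (auto simp: field_simps)
    then show ?thesis using nz perm_prod_constant [OF n C] by blast
  qed
  then have nz: "w (s = e) \<noteq> 0"
    and const: "\<And>p. p permutes UNIV \<Longrightarrow> perm_prod C p = w s / w (s = e)" by auto
  \<comment> \<open>If \<open>\<not> e\<close>, the coefficients at an even and an odd permutation give \<open>\<beta> \<delta> = \<alpha>\<close> and \<open>\<alpha> \<delta> = \<beta>\<close>.\<close>
  have "e"
  proof (rule ccontr)
    assume "\<not> e"
    obtain x y :: 'n where xy: "x \<noteq> y"
      using ex_distinct_from [of "{undefined :: 'n}"] n by auto
    let ?\<delta> = "w s / w (s = e)"
    have "w (\<not> True) * ?\<delta> = w True"
      using coeff [of id] const [of id] \<open>\<not> e\<close> permutes_id [of UNIV] by simp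
    moreover have "w (\<not> False) * ?\<delta> = w False"
      using coeff [of "swap x y"] const [of "swap x y"] \<open>\<not> e\<close> xy
      by (simp add: evenperm_swap permutes_swap_id)
    ultimately have "\<beta> * ?\<delta> = \<alpha>" "\<alpha> * ?\<delta> = \<beta>" by (simp_all add: w_def)
    then have "\<alpha> * \<alpha> = \<beta> * \<beta>" by (metis mult.left_commute)
    then have "(\<alpha> - \<beta>) * (\<alpha> + \<beta>) = 0" by (simp add: algebra_simps)
    then show False using assms(2,3) by (auto simp: eq_neg_iff_add_eq_0)
  qed
  then have "perm_prod C p = 1" if "p permutes UNIV" for p
    using const [OF that] s by simp
  then show ?thesis
    using \<open>e\<close> gen_det_monomial_map [OF T, of a b X] gen_det_eq_sum [of a b X]
    by (simp add: e_def parity_weight_def)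
qed

theorem theorem3:
  fixes \<alpha> \<beta> :: "'a::field_char_0"
  assumes "CARD('n::finite) \<ge> 5" and "\<alpha> \<noteq> \<beta>" and "\<alpha> \<noteq> - \<beta>"
  shows "Stab (gen_det \<alpha> \<beta> :: 'a^'n^'n \<Rightarrow> 'a) = Stab det \<inter> Stab permanent"
proof
  show "Stab (gen_det \<alpha> \<beta> :: 'a^'n^'n \<Rightarrow> 'a) \<subseteq> Stab det \<inter> Stab permanent"
  proof
    fix T :: "'a^'n^'n \<Rightarrow> 'a^'n^'n"
    assume "T \<in> Stab (gen_det \<alpha> \<beta>)"
    then have T: "T \<in> carrier GL_mat" and inv: "\<And>X. gen_det \<alpha> \<beta> (T X) = gen_det \<alpha> \<beta> X"
      by (auto simp: Stab_iff)
    have "rook_clique (supp (T E)) \<longleftrightarrow> rook_clique (supp E)" for E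
      using affine_along_invariant [of T "gen_det \<alpha> \<beta>" E, OF T inv] assms
      by (simp add: affine_along_gen_det_iff)
    then have pres: "preserves_cliques T" using T by (simp add: preserves_cliques_def)
    have "gen_det a b (T X) = gen_det a b X" for a b X
    proof (rule preserves_cliques_cases [OF _ pres])
      fix \<sigma> \<tau> C assume "monomial_map \<sigma> \<tau> C T"
      then show ?thesis by (rule monomial_map_preserves_all_gen_det [OF assms _ inv])
    next
      fix \<sigma> \<tau> C assume "monomial_map \<sigma> \<tau> C (mtranspose \<circ> T)"
      then have "gen_det a b ((mtranspose \<circ> T) X) = gen_det a b X"
        by (rule monomial_map_preserves_all_gen_det [OF assms]) (simp add: gen_det_transpose inv)
      then show ?thesis by (simp add: gen_det_transpose)
    qed (use assms in simp)
    then show "T \<in> Stab det \<inter> Stab permanent"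
      using T by (simp add: Stab_iff det_eq_gen_det permanent_eq_gen_det)
  qed
  show "Stab det \<inter> Stab permanent \<subseteq> Stab (gen_det \<alpha> \<beta> :: 'a^'n^'n \<Rightarrow> 'a)"
  proof
    fix T :: "'a^'n^'n \<Rightarrow> 'a^'n^'n"
    assume "T \<in> Stab det \<inter> Stab permanent"
    then have T: "T \<in> carrier GL_mat"
      and det: "\<And>X. gen_det 1 (-1) (T X) = gen_det 1 (-1) X"
      and perm: "\<And>X. gen_det 1 1 (T X) = gen_det 1 1 X"
      by (auto simp: Stab_iff det_eq_gen_det permanent_eq_gen_det)
    have "gen_det \<alpha> \<beta> A = (\<alpha> - \<beta>) / 2 * gen_det 1 (-1) A + (\<alpha> + \<beta>) / 2 * gen_det 1 1 A" for A :: "'a^'n^'n"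
      by (simp add: gen_det_def field_simps)
    then show "T \<in> Stab (gen_det \<alpha> \<beta>)" using T det perm by (simp add: Stab_iff)
  qed
qed

end
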